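(* Let $F$ be $\mathbb{R}$ or $\mathbb{C}$, let $n,n'$ be fixed nonnegative integers, let $\rho\ge1$ be a fixed real number, and write $\|\cdot\|=\|\cdot\|_\rho$. Let $A,B\in \mathrm{Mat}_{n,n'}(F)$ be such that $\|A\|$ and $\|B\|$ are defined (i.e. finite), and let $\lambda\in F$. Then: (a) $\|A\|=0$ if and only if $A=0$; (b) $\|\lambda A\|=|\lambda|\,\|A\|$; (c) $\|A+B\|\le\|A\|+\|B\|$; (d) $\|A\bigodot B\|\le\|A\|\,\|B\|$.
   Context: For a nonnegative integer $n$, $I_n$ denotes the set of row $n$-tuples $\alpha=(\alpha_1,\dots,\alpha_n)$ of nonnegative integers ($I_0=\{0\}$); $|\alpha|=\alpha_1+\dots+\alpha_n$, $\alpha!=\alpha_1!\cdots\alpha_n!$; $\beta\ll\alpha$ means $\beta_i\le\alpha_i$ for all $i$, and then $\binom{\alpha}{\beta}=\frac{\alpha!}{\beta!(\alpha-\beta)!}$. $M_{n,n'}(p,p';F)$ is the set of matrices $A=(A_{\alpha,\alpha'})$ with entries in $F$, rows indexed by $\alpha\in I_n$ with $|\alpha|=p$ and columns indexed by $\alpha'\in I_{n'}$ with $|\alpha'|=p'$. For $A\in M_{n,n'}(p,p';F)$ and $B\in M_{n,n'}(q,q';F)$, the product $A\bigodot B\in M_{n,n'}(p+q,p'+q';F)$ is defined by $$(A\bigodot B)_{\alpha,\alpha'}=\sum_{\beta,\beta'}\binom{\alpha}{\beta}A_{\beta,\beta'}B_{\alpha-\beta,\alpha'-\beta'},$$ the sum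 being over all $\beta\in I_n$, $\beta'\in I_{n'}$ with $|\beta|=p$, $|\beta'|=p'$, $\beta\ll\alpha$, $\beta'\ll\alpha'$. For $A\in M_{n,n'}(p,p';F)$ put $\|A\|_\rho=\Big(\sum_{\alpha,\alpha'}\frac{|A_{\alpha,\alpha'}|^{\rho}}{\alpha!\,(p!\,p'!)^{\rho-1}}\Big)^{1/\rho}.$ $\mathrm{Mat}_{n,n'}(F)$ is the set of all block matrices $A=(A(p,p'))_{p,p'\ge0}$ with arbitrary blocks $A(p,p')\in M_{n,n'}(p,p';F)$ for all nonnegative integers $p,p'$. Addition and scalar multiplication are blockwise, and the product is $(A\bigodot B)(p,p')=\sum_{0\le q\le p,\,0\le q'\le p'}A(q,q')\bigodot B(p-q,p'-q')$. For $A\in\mathrm{Mat}_{n,n'}(F)$ one sets $\|A\|_\rho=\sum_{p,p'}\|A(p,p')\|_\rho$, whenever this has meaning (i.e. the series converges). *)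

theory Defs
  imports "HOL-Analysis.Analysis" "HOL-Library.Function_Algebras"
begin

text \<open>
  An \<open>n\<close>-tuple of nonnegative integers is a function \<open>nat \<Rightarrow> nat\<close> that vanishes outside
  \<open>{..<n}\<close>. The componentwise order and difference of tuples are then the pointwise \<open>\<le>\<close> and
  \<open>-\<close> on functions, and \<open>n = 0\<close> is allowed.
\<close>

definition multi_index :: "nat \<Rightarrow> (nat \<Rightarrow> nat) set" where
  "multi_index n = {\<alpha>. \<forall>i\<ge>n. \<alpha> i = 0}"

definition mi_size :: "nat \<Rightarrow> (nat \<Rightarrow> nat) \<Rightarrow> nat" where
  "mi_size n \<alpha> = (\<Sum>i<n. \<alpha> i)"

definition mi_fact :: "nat \<Rightarrow> (nat \<Rightarrow> nat) \<Rightarrow> 'a::{comm_semiring_1,semiring_char_0}" where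
  "mi_fact n \<alpha> = (\<Prod>i<n. fact (\<alpha> i))"

definition mi_choose :: "nat \<Rightarrow> (nat \<Rightarrow> nat) \<Rightarrow> (nat \<Rightarrow> nat) \<Rightarrow> 'a::field_char_0" where
  "mi_choose n \<alpha> \<beta> = mi_fact n \<alpha> / (mi_fact n \<beta> * mi_fact n (\<alpha> - \<beta>))"

definition level :: "nat \<Rightarrow> nat \<Rightarrow> (nat \<Rightarrow> nat) set" where
  "level n p = {\<alpha> \<in> multi_index n. mi_size n \<alpha> = p}"

type_synonym 'a block = "(nat \<Rightarrow> nat) \<Rightarrow> (nat \<Rightarrow> nat) \<Rightarrow> 'a"
type_synonym 'a block_matrix = "nat \<Rightarrow> nat \<Rightarrow> 'a block"

text \<open>
  Matrices are total functions that are \<open>0\<close> off their index sets, so that equality of matrices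
  is equality of functions, and \<open>0\<close> and \<open>+\<close> are the pointwise operations.
\<close>

definition Block :: "nat \<Rightarrow> nat \<Rightarrow> nat \<Rightarrow> nat \<Rightarrow> 'a::zero block set" where
  "Block n n' p p' =
     {A. \<forall>\<alpha> \<alpha>'. \<not> (\<alpha> \<in> level n p \<and> \<alpha>' \<in> level n' p') \<longrightarrow> A \<alpha> \<alpha>' = 0}"

definition Mat :: "nat \<Rightarrow> nat \<Rightarrow> 'a::zero block_matrix set" where
  "Mat n n' = {A. \<forall>p p'. A p p' \<in> Block n n' p p'}"

definition block_odot ::
  "nat \<Rightarrow> nat \<Rightarrow> nat \<Rightarrow> nat \<Rightarrow> nat \<Rightarrow> nat \<Rightarrow> 'a::field_char_0 block \<Rightarrow> 'a block \<Rightarrow> 'a block" where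
  "block_odot n n' p p' q q' A B = (\<lambda>\<alpha> \<alpha>'.
     if \<alpha> \<in> level n (p + q) \<and> \<alpha>' \<in> level n' (p' + q')
     then \<Sum>(\<beta>, \<beta>') \<in> {\<beta> \<in> level n p. \<beta> \<le> \<alpha>} \<times> {\<beta>' \<in> level n' p'. \<beta>' \<le> \<alpha>'}.
            mi_choose n \<alpha> \<beta> * A \<beta> \<beta>' * B (\<alpha> - \<beta>) (\<alpha>' - \<beta>')
     else 0)"

definition mat_odot ::
  "nat \<Rightarrow> nat \<Rightarrow> 'a::field_char_0 block_matrix \<Rightarrow> 'a block_matrix \<Rightarrow> 'a block_matrix" where
  "mat_odot n n' A B = (\<lambda>p p'.
     \<Sum>q\<le>p. \<Sum>q'\<le>p'. block_odot n n' q q' (p - q) (p' - q') (A q q') (B (p - q) (p' - q')))"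

definition mat_scale :: "'a::times \<Rightarrow> 'a block_matrix \<Rightarrow> 'a block_matrix" where
  "mat_scale c A = (\<lambda>p p' \<alpha> \<alpha>'. c * A p p' \<alpha> \<alpha>')"

text \<open>
  By the Gelfand--Mazur theorem, the instances of \<open>real_normed_field\<close> (whose norm is
  multiplicative) are the reals and the complex numbers, up to isometric isomorphism.
\<close>

definition block_norm ::
  "real \<Rightarrow> nat \<Rightarrow> nat \<Rightarrow> nat \<Rightarrow> nat \<Rightarrow> 'a::real_normed_field block \<Rightarrow> real" where
  "block_norm \<rho> n n' p p' A =
     (\<Sum>(\<alpha>, \<alpha>') \<in> level n p \<times> level n' p'.
        norm (A \<alpha> \<alpha>') powr \<rho> / (mi_fact n \<alpha> * (fact p * fact p') powr (\<rho> - 1))) powr (1 / \<rho>)"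

text \<open>
  \<open>infsum\<close> is \<open>0\<close> on families that are not summable, so finiteness of the norm is kept as a
  separate predicate. The terms are nonnegative, so unordered summability is plain convergence.
\<close>

definition mat_norm_defined ::
  "real \<Rightarrow> nat \<Rightarrow> nat \<Rightarrow> 'a::real_normed_field block_matrix \<Rightarrow> bool" where
  "mat_norm_defined \<rho> n n' A \<longleftrightarrow>
     (\<lambda>(p, p'). block_norm \<rho> n n' p p' (A p p')) summable_on UNIV"

definition mat_norm ::
  "real \<Rightarrow> nat \<Rightarrow> nat \<Rightarrow> 'a::real_normed_field block_matrix \<Rightarrow> real" where
  "mat_norm \<rho> n n' A = (\<Sum>\<^sub>\<infinity>(p, p'). block_norm \<rho> n n' p p' (A p p'))"

lemma finite_level: "finite (level n p)"
proof (rule finite_subset)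
  let ?S = "{f. \<forall>i. (i \<in> {..<n} \<longrightarrow> f i \<in> {..p}) \<and> (i \<notin> {..<n} \<longrightarrow> f i = (0::nat))}"
  show "level n p \<subseteq> ?S"
    by (auto simp: level_def multi_index_def mi_size_def intro: member_le_sum)
  show "finite ?S"
    by (rule finite_set_of_finite_funs) auto
qed

lemma level_0: "level 0 p = (if p = 0 then {\<lambda>_. 0} else {})"
  by (auto simp: level_def multi_index_def mi_size_def)

lemma block_odot_closed: "block_odot n n' p p' q q' A B \<in> Block n n' (p + q) (p' + q')"
  by (auto simp: Block_def block_odot_def)

lemma Block_sum:
  assumes "\<And>i. i \<in> I \<Longrightarrow> f i \<in> Block n n' p p'"
  shows "sum f I \<in> (Block n n' p p' :: 'a::comm_monoid_add block set)"
  using assms by (induction I rule: infinite_finite_induct) (auto simp: Block_def)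

lemma mat_odot_closed: "mat_odot n n' A B \<in> Mat n n'"
proof -
  have "block_odot n n' q q' (p - q) (p' - q') C D \<in> Block n n' p p'"
    if "q \<le> p" "q' \<le> p'" for p p' q q' and C D :: "'a block"
    using block_odot_closed[of n n' q q' "p - q" "p' - q'" C D] that by simp
  then show ?thesis
    by (auto simp: Mat_def mat_odot_def intro!: Block_sum)
qed

end

theory Submission
  imports Defs
begin

text \<open>
  On a single block the norm is an \<open>\<ell>\<^sup>\<rho>\<close> norm with positive weights, so definiteness and
  homogeneity are immediate and the triangle inequality is Minkowski's
  (\<open>weighted_minkowski\<close>). These three properties pass from blocks to block matrices
  because \<open>mat_norm\<close> is a sum of nonnegative block norms.

  The substance is the submultiplicativity on blocks, \<open>block_norm_odot_le\<close>. The entry of the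
  product at \<open>(\<alpha>, \<alpha>')\<close> is a sum over pairs \<open>(\<beta>, \<beta>')\<close> with coefficients \<open>binom \<alpha> \<beta>\<close>. By the
  Vandermonde identity for multi-indices, the sum of \<open>binom \<alpha> \<beta>\<close> over \<open>\<beta>\<close> with \<open>|\<beta>| = p\<close> is
  \<open>binom (p + q) p\<close>, and the number of the \<open>\<beta>'\<close> is at most \<open>binom (p' + q') p'\<close>, since each
  \<open>binom \<alpha>' \<beta>'\<close> is at least \<open>1\<close>. Let \<open>C\<close> be the product of these two numbers. Convexity of
  \<open>x \<mapsto> x\<^sup>\<rho>\<close> then gives
  \<open>|(A \<odot> B) \<alpha> \<alpha>'|\<^sup>\<rho> \<le> C\<^bsup>\<rho>-1\<^esup> \<Sum> binom \<alpha> \<beta> |A \<beta> \<beta>'|\<^sup>\<rho> |B (\<alpha>-\<beta>) (\<alpha>'-\<beta>')|\<^sup>\<rho>\<close>.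
  The weights in the norm are made for this bound: \<open>C\<^bsup>\<rho>-1\<^esup>\<close> turns \<open>((p+q)! (p'+q')!)\<^bsup>\<rho>-1\<^esup>\<close> into
  \<open>(p! p'!)\<^bsup>\<rho>-1\<^esup> (q! q'!)\<^bsup>\<rho>-1\<^esup>\<close>, and \<open>binom \<alpha> \<beta>\<close> turns \<open>\<alpha>!\<close> into \<open>\<beta>! (\<alpha>-\<beta>)!\<close>. The right-hand
  side is then a convolution, and summing it over \<open>(\<alpha>, \<alpha>')\<close> gives exactly the product of the
  \<open>\<rho>\<close>-th powers of the two norms.

  For block matrices, the norm of \<open>mat_odot n n' A B\<close> is therefore dominated term by term by
  the Cauchy product of two absolutely convergent double series.
\<close>

section \<open>Convexity of powers\<close>

text \<open>
  Only the endpoint \<open>0\<close> goes beyond convexity on the positive reals. There the inequality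
  reads \<open>(u z)\<^sup>\<rho> \<le> u z\<^sup>\<rho>\<close> for \<open>0 < u < 1\<close>, which holds because \<open>u\<^sup>\<rho> \<le> u\<close>.
\<close>

lemma convex_on_powr_nonneg:
  fixes \<rho> :: real
  assumes "\<rho> \<ge> 1"
  shows "convex_on {0..} (\<lambda>x. x powr \<rho>)"
proof (rule convex_onI)
  fix t x y :: real
  assume t: "0 < t" "t < 1" and xy: "x \<in> {0..}" "y \<in> {0..}"
  have contract: "(u * z) powr \<rho> \<le> u * z powr \<rho>" if "0 < u" "u < 1" "0 \<le> z" for u z :: real
  proof -
    have "u powr \<rho> \<le> u powr 1"
      using that assms by (intro powr_mono') auto
    then show ?thesis
      using that by (simp add: powr_mult mult_right_mono)
  qed
  consider "x = 0" | "y = 0" | "x > 0" "y > 0"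
    using xy by fastforce
  then show "((1 - t) *\<^sub>R x + t *\<^sub>R y) powr \<rho> \<le> (1 - t) * x powr \<rho> + t * y powr \<rho>"
  proof cases
    case 1
    then show ?thesis using contract[of t y] t xy by simp
  next
    case 2
    then show ?thesis using contract[of "1 - t" x] t xy by simp
  next
    case 3
    then show ?thesis using convex_onD[OF powr_convex[OF assms], of t x y] t by simp
  qed
qed (simp add: convex_real_interval)

text \<open>
  Jensen's inequality for \<open>x \<mapsto> x\<^sup>\<rho>\<close>, in the form that Hoelder's inequality takes when one
  factor is constant: an upper bound \<open>C\<close> for the total mass replaces its normalisation to \<open>1\<close>.
\<close>

lemma powr_weighted_sum_le:
  fixes w x :: "'i \<Rightarrow> real"
  assumes "\<rho> \<ge> 1" "finite S"
    and w: "\<And>i. i \<in> S \<Longrightarrow> w i \<ge> 0" and x: "\<And>i. i \<in> S \<Longrightarrow> x i \<ge> 0"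
    and C: "(\<Sum>i\<in>S. w i) \<le> C"
  shows "(\<Sum>i\<in>S. w i * x i) powr \<rho> \<le> C powr (\<rho> - 1) * (\<Sum>i\<in>S. w i * x i powr \<rho>)"
proof -
  define W where "W = (\<Sum>i\<in>S. w i)"
  have nonneg: "0 \<le> (\<Sum>i\<in>S. w i * x i powr \<rho>)"
    using w by (intro sum_nonneg) simp
  show ?thesis
  proof (cases "W = 0")
    case True
    then have "\<And>i. i \<in> S \<Longrightarrow> w i = 0"
      using sum_nonneg_eq_0_iff[of S w] w \<open>finite S\<close> by (auto simp: W_def)
    then show ?thesis by simp
  next
    case False
    then have W: "W > 0"
      using sum_nonneg[of S w] w by (force simp: W_def)
    then have "S \<noteq> {}" by (auto simp: W_def)
    have "(\<Sum>i\<in>S. w i * x i) powr \<rho> = (W * (\<Sum>i\<in>S. (w i / W) *\<^sub>R x i)) powr \<rho>"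
      using W by (simp add: sum_distrib_left)
    also have "\<dots> = W powr \<rho> * (\<Sum>i\<in>S. (w i / W) *\<^sub>R x i) powr \<rho>"
      using W w x by (intro powr_mult)
    also have "\<dots> \<le> W powr \<rho> * (\<Sum>i\<in>S. (w i / W) * x i powr \<rho>)"
    proof (intro mult_left_mono convex_on_sum[OF \<open>finite S\<close> \<open>S \<noteq> {}\<close> convex_on_powr_nonneg])
      show "(\<Sum>i\<in>S. w i / W) = 1"
        using W by (simp add: W_def flip: sum_divide_distrib)
    qed (use W w x assms in auto)
    also have "\<dots> = W powr \<rho> / W * (\<Sum>i\<in>S. w i * x i powr \<rho>)"
      by (simp add: sum_distrib_left)
    also have "W powr \<rho> / W = W powr (\<rho> - 1)"
      using W by (simp add: powr_diff)
    also have "W powr (\<rho> - 1) * (\<Sum>i\<in>S. w i * x i powr \<rho>)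
        \<le> C powr (\<rho> - 1) * (\<Sum>i\<in>S. w i * x i powr \<rho>)"
      using C W \<open>\<rho> \<ge> 1\<close> nonneg by (intro mult_right_mono powr_mono2) (auto simp: W_def)
    finally show ?thesis .
  qed
qed

text \<open>
  The convexity proof of Minkowski's inequality: if \<open>a\<close> and \<open>b\<close> bound the norms of \<open>f\<close> and
  \<open>g\<close>, then \<open>(f + g) / (a + b)\<close> is a convex combination of \<open>f / a\<close> and \<open>g / b\<close>, both of norm at
  most \<open>1\<close>. Dividing by the weights \<open>w\<close> matches the shape of \<open>block_norm\<close>.
\<close>

lemma weighted_minkowski:
  fixes f g w :: "'i \<Rightarrow> real"
  assumes "\<rho> \<ge> 1" "finite S"
    and w: "\<And>i. i \<in> S \<Longrightarrow> w i \<ge> 0"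
    and f: "\<And>i. i \<in> S \<Longrightarrow> f i \<ge> 0" and g: "\<And>i. i \<in> S \<Longrightarrow> g i \<ge> 0"
  shows "(\<Sum>i\<in>S. (f i + g i) powr \<rho> / w i) powr (1 / \<rho>)
    \<le> (\<Sum>i\<in>S. f i powr \<rho> / w i) powr (1 / \<rho>) + (\<Sum>i\<in>S. g i powr \<rho> / w i) powr (1 / \<rho>)"
proof (rule field_le_epsilon)
  fix e :: real assume "e > 0"
  define N where "N h = (\<Sum>i\<in>S. h i powr \<rho> / w i) powr (1 / \<rho>)" for h
  \<comment> \<open>Exceeding the two norms by \<open>e / 2\<close> makes \<open>a\<close> and \<open>b\<close> valid divisors even for a vanishing norm.\<close>
  define a b where "a = N f + e / 2" and "b = N g + e / 2"
  have N0: "N h \<ge> 0" for h by (simp add: N_def)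
  have ab: "a > 0" "b > 0"
    using N0[of f] N0[of g] \<open>e > 0\<close> by (auto simp: a_def b_def)
  have scaled: "(\<Sum>i\<in>S. (h i / c) powr \<rho> / w i) \<le> 1"
    if "N h \<le> c" "c > 0" "\<And>i. i \<in> S \<Longrightarrow> h i \<ge> 0" for h c
  proof -
    have "(\<Sum>i\<in>S. h i powr \<rho> / w i) \<ge> 0"
      using w by (intro sum_nonneg) simp
    then have "(\<Sum>i\<in>S. h i powr \<rho> / w i) = N h powr \<rho>"
      using \<open>\<rho> \<ge> 1\<close> by (simp add: N_def powr_powr)
    also have "\<dots> \<le> c powr \<rho>"
      using that N0 \<open>\<rho> \<ge> 1\<close> by (intro powr_mono2) auto
    finally have "(\<Sum>i\<in>S. h i powr \<rho> / w i) / c powr \<rho> \<le> 1"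
      using \<open>c > 0\<close> by simp
    also have "(\<Sum>i\<in>S. h i powr \<rho> / w i) / c powr \<rho> = (\<Sum>i\<in>S. (h i / c) powr \<rho> / w i)"
      unfolding sum_divide_distrib using that by (intro sum.cong) (auto simp: powr_divide)
    finally show ?thesis .
  qed
  define t where "t = b / (a + b)"
  have t: "0 \<le> t" "t \<le> 1" "1 - t = a / (a + b)"
    using ab by (auto simp: t_def field_simps)
  have "(\<Sum>i\<in>S. ((f i + g i) / (a + b)) powr \<rho> / w i)
    \<le> (\<Sum>i\<in>S. ((1 - t) * (f i / a) powr \<rho> + t * (g i / b) powr \<rho>) / w i)"
  proof (intro sum_mono divide_right_mono)
    fix i assume i: "i \<in> S"
    have "(f i + g i) / (a + b) = (1 - t) *\<^sub>R (f i / a) + t *\<^sub>R (g i / b)"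
      unfolding t(3) using ab by (simp add: t_def add_divide_distrib)
    then show "((f i + g i) / (a + b)) powr \<rho>
        \<le> (1 - t) * (f i / a) powr \<rho> + t * (g i / b) powr \<rho>"
      using convex_onD[OF convex_on_powr_nonneg[OF \<open>\<rho> \<ge> 1\<close>] t(1,2), of "f i / a" "g i / b"]
        f[OF i] g[OF i] ab by simp
  qed (use w in auto)
  also have "\<dots> = (1 - t) * (\<Sum>i\<in>S. (f i / a) powr \<rho> / w i)
      + t * (\<Sum>i\<in>S. (g i / b) powr \<rho> / w i)"
    by (simp add: add_divide_distrib sum.distrib sum_distrib_left)
  also have "\<dots> \<le> (1 - t) * 1 + t * 1"
    using t \<open>e > 0\<close> ab f g
    by (intro add_mono mult_left_mono scaled) (auto simp: a_def b_def)
  finally have "(\<Sum>i\<in>S. ((f i + g i) / (a + b)) powr \<rho> / w i) \<le> 1"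
    by simp
  also have "(\<Sum>i\<in>S. ((f i + g i) / (a + b)) powr \<rho> / w i)
      = (\<Sum>i\<in>S. (f i + g i) powr \<rho> / w i) / (a + b) powr \<rho>"
    unfolding sum_divide_distrib using f g ab
    by (intro sum.cong) (auto simp: powr_divide)
  finally have "(\<Sum>i\<in>S. (f i + g i) powr \<rho> / w i) \<le> (a + b) powr \<rho>"
    using ab by simp
  then have "N (\<lambda>i. f i + g i) \<le> ((a + b) powr \<rho>) powr (1 / \<rho>)"
    unfolding N_def using w \<open>\<rho> \<ge> 1\<close> by (intro powr_mono2 sum_nonneg) auto
  also have "\<dots> = N f + N g + e"
    using ab \<open>\<rho> \<ge> 1\<close> by (simp add: powr_powr a_def b_def)
  finally show "(\<Sum>i\<in>S. (f i + g i) powr \<rho> / w i) powr (1 / \<rho>)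
    \<le> (\<Sum>i\<in>S. f i powr \<rho> / w i) powr (1 / \<rho>) + (\<Sum>i\<in>S. g i powr \<rho> / w i) powr (1 / \<rho>) + e"
    by (simp add: N_def)
qed

section \<open>Binomial coefficients of multi-indices\<close>

text \<open>
  Splitting off the last component \<open>k\<close> of \<open>\<beta>\<close> leaves a multi-index of size \<open>p - k\<close>, so the
  ordinary Vandermonde identity is the induction step. Only \<open>\<beta> \<le> \<alpha>\<close> contribute, because
  \<open>\<alpha> i choose \<beta> i\<close> vanishes when \<open>\<beta> i > \<alpha> i\<close>.
\<close>

lemma multi_index_vandermonde:
  "(\<Sum>\<beta>\<in>level n p. \<Prod>i<n. \<alpha> i choose \<beta> i) = (mi_size n \<alpha> choose p)"
proof (induction n arbitrary: p)
  case 0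
  then show ?case by (simp add: level_0 mi_size_def)
next
  case (Suc n)
  have "(\<Sum>\<beta>\<in>level (Suc n) p. \<Prod>i<Suc n. \<alpha> i choose \<beta> i)
    = (\<Sum>(k, \<gamma>)\<in>Sigma {..p} (\<lambda>k. level n (p - k)). (\<alpha> n choose k) * (\<Prod>i<n. \<alpha> i choose \<gamma> i))"
    by (rule sum.reindex_bij_witness
        [where i = "\<lambda>(k, \<gamma>). \<gamma>(n := k)" and j = "\<lambda>\<beta>. (\<beta> n, \<beta>(n := 0))"])
      (auto simp: level_def multi_index_def mi_size_def le_Suc_eq intro!: ext)
  also have "\<dots> = (\<Sum>k\<le>p. (\<alpha> n choose k) * (mi_size n \<alpha> choose (p - k)))"
    by (simp add: sum.Sigma[symmetric] finite_level Suc.IH flip: sum_distrib_left)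
  also have "\<dots> = (mi_size (Suc n) \<alpha> choose p)"
    by (simp add: vandermonde mi_size_def add.commute)
  finally show ?case .
qed

lemma mi_choose_eq_prod:
  assumes "\<beta> \<le> \<alpha>"
  shows "mi_choose n \<alpha> \<beta> = of_nat (\<Prod>i<n. \<alpha> i choose \<beta> i)"
  using assms
  by (simp add: mi_choose_def mi_fact_def binomial_fact le_fun_def prod_dividef prod.distrib)

lemma level_minus:
  assumes "\<alpha> \<in> level n (p + q)" "\<beta> \<in> level n p" "\<beta> \<le> \<alpha>"
  shows "\<alpha> - \<beta> \<in> level n q"
proof -
  have "(\<Sum>i<n. \<alpha> i - \<beta> i) = (\<Sum>i<n. \<alpha> i) - (\<Sum>i<n. \<beta> i)"
    using assms(3) by (intro sum_subtractf_nat) (auto simp: le_fun_def)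
  then show ?thesis
    using assms(1,2) by (auto simp: level_def multi_index_def mi_size_def)
qed

lemma level_plus:
  assumes "\<beta> \<in> level n p" "\<gamma> \<in> level n q"
  shows "\<beta> + \<gamma> \<in> level n (p + q)"
  using assms by (auto simp: level_def multi_index_def mi_size_def sum.distrib)

lemma sum_mi_choose_le:
  assumes "\<alpha> \<in> level n (p + q)"
  shows "(\<Sum>\<beta> | \<beta> \<in> level n p \<and> \<beta> \<le> \<alpha>. mi_choose n \<alpha> \<beta>) \<le> real (p + q choose p)"
proof -
  have "(\<Sum>\<beta> | \<beta> \<in> level n p \<and> \<beta> \<le> \<alpha>. mi_choose n \<alpha> \<beta>)
      = real (\<Sum>\<beta> | \<beta> \<in> level n p \<and> \<beta> \<le> \<alpha>. \<Prod>i<n. \<alpha> i choose \<beta> i)"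
    by (simp add: mi_choose_eq_prod)
  also have "\<dots> \<le> real (\<Sum>\<beta>\<in>level n p. \<Prod>i<n. \<alpha> i choose \<beta> i)"
    unfolding of_nat_le_iff by (intro sum_mono2 finite_level) auto
  also have "\<dots> = real (p + q choose p)"
    using assms by (simp only: multi_index_vandermonde) (simp add: level_def)
  finally show ?thesis .
qed

text \<open>
  Each \<open>\<beta> \<le> \<alpha>\<close> contributes at least \<open>1\<close> to the Vandermonde sum.
\<close>

lemma card_level_le:
  assumes "\<alpha> \<in> level n (p + q)"
  shows "card {\<beta> \<in> level n p. \<beta> \<le> \<alpha>} \<le> p + q choose p"
proof -
  have "card {\<beta> \<in> level n p. \<beta> \<le> \<alpha>} \<le> (\<Sum>\<beta> | \<beta> \<in> level n p \<and> \<beta> \<le> \<alpha>. \<Prod>i<n. \<alpha> i choose \<beta> i)"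
    unfolding card_eq_sum
  proof (rule sum_mono)
    fix \<beta> assume "\<beta> \<in> {\<beta> \<in> level n p. \<beta> \<le> \<alpha>}"
    then have "1 \<le> \<alpha> i choose \<beta> i" for i
      by (simp add: le_fun_def Suc_le_eq)
    then show "1 \<le> (\<Prod>i<n. \<alpha> i choose \<beta> i)"
      by (intro prod_ge_1) auto
  qed
  also have "\<dots> \<le> (\<Sum>\<beta>\<in>level n p. \<Prod>i<n. \<alpha> i choose \<beta> i)"
    by (intro sum_mono2 finite_level) auto
  also have "\<dots> = (p + q choose p)"
    using assms by (simp only: multi_index_vandermonde) (simp add: level_def)
  finally show ?thesis .
qed

section \<open>The norm of one block\<close>

lemma mi_fact_pos: "mi_fact n \<alpha> > (0::real)"
  by (simp add: mi_fact_def prod_pos)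

abbreviation block_weight :: "real \<Rightarrow> nat \<Rightarrow> nat \<Rightarrow> nat \<Rightarrow> (nat \<Rightarrow> nat) \<Rightarrow> real" where
  "block_weight \<rho> n p p' \<alpha> \<equiv> mi_fact n \<alpha> * (fact p * fact p') powr (\<rho> - 1)"

lemma block_weight_pos: "block_weight \<rho> n p p' \<alpha> > 0"
  by (simp add: mi_fact_pos)

lemma block_norm_nonneg: "block_norm \<rho> n n' p p' A \<ge> 0"
  by (simp add: block_norm_def)

lemma block_norm_zero: "block_norm \<rho> n n' p p' 0 = 0"
  by (simp add: block_norm_def)

lemma block_norm_powr:
  assumes "\<rho> \<ge> 1"
  shows "block_norm \<rho> n n' p p' A powr \<rho> =
    (\<Sum>(\<alpha>, \<alpha>') \<in> level n p \<times> level n' p'. norm (A \<alpha> \<alpha>') powr \<rho> / block_weight \<rho> n p p' \<alpha>)"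
proof -
  have "0 \<le> (\<Sum>(\<alpha>, \<alpha>') \<in> level n p \<times> level n' p'.
      norm (A \<alpha> \<alpha>') powr \<rho> / block_weight \<rho> n p p' \<alpha>)"
    by (intro sum_nonneg) (auto simp: less_imp_le[OF mi_fact_pos])
  then show ?thesis
    using assms by (simp add: block_norm_def powr_powr)
qed

lemma block_norm_eq_0_imp:
  assumes "\<rho> \<ge> 1" "A \<in> Block n n' p p'" "block_norm \<rho> n n' p p' A = 0"
  shows "A = 0"
proof -
  have "A \<alpha> \<alpha>' = 0" if mem: "\<alpha> \<in> level n p" "\<alpha>' \<in> level n' p'" for \<alpha> \<alpha>'
  proof -
    have "(\<Sum>(\<alpha>, \<alpha>') \<in> level n p \<times> level n' p'.
        norm (A \<alpha> \<alpha>') powr \<rho> / block_weight \<rho> n p p' \<alpha>) = 0"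
      using block_norm_powr[OF assms(1), of n n' p p' A] assms(3) by simp
    then have "norm (A \<alpha> \<alpha>') powr \<rho> / block_weight \<rho> n p p' \<alpha> = 0"
      using mem by (subst (asm) sum_nonneg_eq_0_iff)
        (auto simp: finite_level less_imp_le[OF mi_fact_pos])
    then show ?thesis
      using less_imp_neq[OF mi_fact_pos, of n \<alpha>] by simp
  qed
  then show ?thesis
    using assms(2) by (fastforce simp: Block_def zero_fun_def)
qed

lemma block_norm_scale:
  assumes "\<rho> \<ge> 1"
  shows "block_norm \<rho> n n' p p' (\<lambda>\<alpha> \<alpha>'. c * A \<alpha> \<alpha>') = norm c * block_norm \<rho> n n' p p' A"
proof -
  let ?s = "\<Sum>(\<alpha>, \<alpha>') \<in> level n p \<times> level n' p'.
      norm (A \<alpha> \<alpha>') powr \<rho> / block_weight \<rho> n p p' \<alpha>"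
  have "block_norm \<rho> n n' p p' (\<lambda>\<alpha> \<alpha>'. c * A \<alpha> \<alpha>') = (norm c powr \<rho> * ?s) powr (1 / \<rho>)"
    by (simp add: block_norm_def norm_mult powr_mult sum_distrib_left case_prod_unfold)
  also have "\<dots> = (norm c powr \<rho>) powr (1 / \<rho>) * ?s powr (1 / \<rho>)"
    by (rule powr_mult)
  also have "(norm c powr \<rho>) powr (1 / \<rho>) = norm c"
    using assms by (simp add: powr_powr)
  finally show ?thesis
    by (simp add: block_norm_def)
qed

lemma block_norm_add_le:
  assumes "\<rho> \<ge> 1"
  shows "block_norm \<rho> n n' p p' (A + B) \<le> block_norm \<rho> n n' p p' A + block_norm \<rho> n n' p p' B"
proof -
  let ?L = "level n p \<times> level n' p'"
  let ?w = "\<lambda>x. block_weight \<rho> n p p' (fst x)"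
  let ?N = "\<lambda>M x. norm (M (fst x) (snd x) :: 'a)"
  have "(\<Sum>x\<in>?L. ?N (A + B) x powr \<rho> / ?w x) \<le> (\<Sum>x\<in>?L. (?N A x + ?N B x) powr \<rho> / ?w x)"
    using assms by (intro sum_mono divide_right_mono powr_mono2)
      (auto simp: norm_triangle_ineq less_imp_le[OF mi_fact_pos])
  then have "block_norm \<rho> n n' p p' (A + B)
      \<le> (\<Sum>x\<in>?L. (?N A x + ?N B x) powr \<rho> / ?w x) powr (1 / \<rho>)"
    unfolding block_norm_def case_prod_unfold using assms
    by (intro powr_mono2 sum_nonneg) (auto simp: less_imp_le[OF mi_fact_pos])
  also have "\<dots> \<le> block_norm \<rho> n n' p p' A + block_norm \<rho> n n' p p' B"
    unfolding block_norm_def case_prod_unfold using assms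
    by (intro weighted_minkowski) (auto simp: finite_level less_imp_le[OF mi_fact_pos])
  finally show ?thesis .
qed

lemma block_norm_sum_le:
  assumes "\<rho> \<ge> 1"
  shows "block_norm \<rho> n n' p p' (\<Sum>i\<in>I. f i) \<le> (\<Sum>i\<in>I. block_norm \<rho> n n' p p' (f i))"
proof (induction I rule: infinite_finite_induct)
  case (insert i I)
  then show ?case
    using block_norm_add_le[OF assms, of n n' p p' "f i" "sum f I"]
    by (simp only: sum.insert[OF insert(1,2)])
qed (simp_all add: block_norm_def)

text \<open>
  The pointwise estimate behind submultiplicativity. Jensen's inequality is applied with the
  weights \<open>mi_choose n \<alpha> \<beta>\<close> on the pairs \<open>(\<beta>, \<beta>')\<close>; their total mass is at most \<open>C\<close>, and \<open>C\<close>
  together with these weights converts the block weight at \<open>\<alpha>\<close> into the product of the block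
  weights at \<open>\<beta>\<close> and \<open>\<alpha> - \<beta>\<close>.
\<close>

lemma block_odot_entry_le:
  fixes A B :: "'a::real_normed_field block"
  assumes "\<rho> \<ge> 1" and \<alpha>: "\<alpha> \<in> level n (p + q)" and \<alpha>': "\<alpha>' \<in> level n' (p' + q')"
  shows "norm (block_odot n n' p p' q q' A B \<alpha> \<alpha>') powr \<rho> / block_weight \<rho> n (p + q) (p' + q') \<alpha>
    \<le> (\<Sum>(\<beta>, \<beta>') \<in> {\<beta> \<in> level n p. \<beta> \<le> \<alpha>} \<times> {\<beta>' \<in> level n' p'. \<beta>' \<le> \<alpha>'}.
        (norm (A \<beta> \<beta>') powr \<rho> / block_weight \<rho> n p p' \<beta>) *
        (norm (B (\<alpha> - \<beta>) (\<alpha>' - \<beta>')) powr \<rho> / block_weight \<rho> n q q' (\<alpha> - \<beta>)))"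
proof -
  let ?T = "{\<beta> \<in> level n p. \<beta> \<le> \<alpha>} \<times> {\<beta>' \<in> level n' p'. \<beta>' \<le> \<alpha>'}"
  define C where "C = real ((p + q choose p) * (p' + q' choose p'))"
  define x where "x = (\<lambda>(\<beta>, \<beta>'). norm (A \<beta> \<beta>') * norm (B (\<alpha> - \<beta>) (\<alpha>' - \<beta>')))"
  have fin: "finite ?T" by (auto intro: finite_subset[OF _ finite_level])
  have "C > 0" by (simp add: C_def)
  have norm_choose: "norm (mi_choose n \<alpha> \<beta> :: 'a) = mi_choose n \<alpha> \<beta>" if "\<beta> \<le> \<alpha>" for \<beta>
    unfolding mi_choose_eq_prod[OF that] by (rule norm_of_nat)
  have choose_nonneg: "0 \<le> (mi_choose n \<alpha> \<beta> :: real)" for \<beta>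
    by (simp add: mi_choose_def less_imp_le[OF mi_fact_pos])
  have "norm (block_odot n n' p p' q q' A B \<alpha> \<alpha>') \<le> (\<Sum>y\<in>?T. mi_choose n \<alpha> (fst y) * x y)"
    unfolding block_odot_def using \<alpha> \<alpha>'
    by (auto simp: x_def norm_mult norm_choose case_prod_unfold mult.assoc
        intro!: order.trans[OF norm_sum] sum_mono)
  then have "norm (block_odot n n' p p' q q' A B \<alpha> \<alpha>') powr \<rho>
      \<le> (\<Sum>y\<in>?T. mi_choose n \<alpha> (fst y) * x y) powr \<rho>"
    using \<open>\<rho> \<ge> 1\<close> by (intro powr_mono2) auto
  also have "\<dots> \<le> C powr (\<rho> - 1) * (\<Sum>y\<in>?T. mi_choose n \<alpha> (fst y) * x y powr \<rho>)"
  proof (rule powr_weighted_sum_le[OF \<open>\<rho> \<ge> 1\<close> fin])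
    have "(\<Sum>y\<in>?T. mi_choose n \<alpha> (fst y))
        = (\<Sum>\<beta> | \<beta> \<in> level n p \<and> \<beta> \<le> \<alpha>. mi_choose n \<alpha> \<beta>)
          * real (card {\<beta>' \<in> level n' p'. \<beta>' \<le> \<alpha>'})"
      by (simp add: sum.cartesian_product' sum_distrib_left sum_distrib_right mult.commute)
    also have "\<dots> \<le> C"
      unfolding C_def of_nat_mult using sum_mi_choose_le[OF \<alpha>] card_level_le[OF \<alpha>']
      by (intro mult_mono) auto
    finally show "(\<Sum>y\<in>?T. mi_choose n \<alpha> (fst y)) \<le> C" .
  qed (auto simp: choose_nonneg x_def)
  finally have "norm (block_odot n n' p p' q q' A B \<alpha> \<alpha>') powr \<rho>
        / block_weight \<rho> n (p + q) (p' + q') \<alpha>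
      \<le> C powr (\<rho> - 1) * (\<Sum>y\<in>?T. mi_choose n \<alpha> (fst y) * x y powr \<rho>)
        / block_weight \<rho> n (p + q) (p' + q') \<alpha>"
    using less_imp_le[OF block_weight_pos] by (rule divide_right_mono)
  also have "\<dots> = (\<Sum>(\<beta>, \<beta>')\<in>?T.
        (norm (A \<beta> \<beta>') powr \<rho> / block_weight \<rho> n p p' \<beta>) *
        (norm (B (\<alpha> - \<beta>) (\<alpha>' - \<beta>')) powr \<rho> / block_weight \<rho> n q q' (\<alpha> - \<beta>)))"
    unfolding sum_distrib_left sum_divide_distrib
  proof (rule sum.cong[OF refl], clarify)
    fix \<beta> \<beta>'
    have "(fact (p + q) * fact (p' + q') :: real)
        = C * ((fact p * fact p') * (fact q * fact q'))"
      by (simp add: C_def binomial_fact)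
    then have "(fact (p + q) * fact (p' + q') :: real) powr (\<rho> - 1)
        = C powr (\<rho> - 1) * ((fact p * fact p') powr (\<rho> - 1) * (fact q * fact q') powr (\<rho> - 1))"
      by (simp only: powr_mult)
    moreover have "C powr (\<rho> - 1) \<noteq> 0" using \<open>C > 0\<close> by simp
    ultimately show "C powr (\<rho> - 1) * (mi_choose n \<alpha> (fst (\<beta>, \<beta>')) * x (\<beta>, \<beta>') powr \<rho>)
        / block_weight \<rho> n (p + q) (p' + q') \<alpha>
      = (norm (A \<beta> \<beta>') powr \<rho> / block_weight \<rho> n p p' \<beta>) *
        (norm (B (\<alpha> - \<beta>) (\<alpha>' - \<beta>')) powr \<rho> / block_weight \<rho> n q q' (\<alpha> - \<beta>))"
      using less_imp_neq[OF mi_fact_pos, of n \<alpha>]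
      by (simp add: x_def mi_choose_def powr_mult)
  qed
  finally show ?thesis .
qed

text \<open>
  The map \<open>(\<alpha>, \<beta>) \<mapsto> (\<beta>, \<alpha> - \<beta>)\<close> is a bijection between the pairs with \<open>\<beta> \<le> \<alpha>\<close>,
  \<open>|\<beta>| = p\<close>, \<open>|\<alpha>| = p + q\<close> and the product of the levels \<open>p\<close> and \<open>q\<close>; likewise for the
  primed indices.
\<close>

lemma sum_level_convolution:
  fixes F :: "(nat \<Rightarrow> nat) \<Rightarrow> (nat \<Rightarrow> nat) \<Rightarrow> (nat \<Rightarrow> nat) \<Rightarrow> (nat \<Rightarrow> nat) \<Rightarrow> 'b::comm_monoid_add"
  shows "(\<Sum>(\<alpha>, \<alpha>') \<in> level n (p + q) \<times> level n' (p' + q').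
      \<Sum>(\<beta>, \<beta>') \<in> {\<beta> \<in> level n p. \<beta> \<le> \<alpha>} \<times> {\<beta>' \<in> level n' p'. \<beta>' \<le> \<alpha>'}.
        F \<beta> \<beta>' (\<alpha> - \<beta>) (\<alpha>' - \<beta>'))
    = (\<Sum>(\<beta>, \<beta>') \<in> level n p \<times> level n' p'. \<Sum>(\<gamma>, \<gamma>') \<in> level n q \<times> level n' q'. F \<beta> \<beta>' \<gamma> \<gamma>')"
proof -
  let ?T = "\<lambda>(\<alpha>, \<alpha>'). {\<beta> \<in> level n p. \<beta> \<le> \<alpha>} \<times> {\<beta>' \<in> level n' p'. \<beta>' \<le> \<alpha>'}"
  have fin: "finite {\<beta> \<in> level m r. \<beta> \<le> \<alpha>}" for m r \<alpha>
    by (auto intro: finite_subset[OF _ finite_level])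
  have sub: "\<beta> + (\<alpha> - \<beta>) = \<alpha>" if "\<beta> \<le> \<alpha>" for \<alpha> \<beta> :: "nat \<Rightarrow> nat"
    using that by (auto simp: le_fun_def)
  have add: "\<beta> + \<gamma> - \<beta> = \<gamma>" for \<beta> \<gamma> :: "nat \<Rightarrow> nat"
    by auto
  have le: "\<beta> \<le> \<beta> + \<gamma>" for \<beta> \<gamma> :: "nat \<Rightarrow> nat"
    by (simp add: le_fun_def)
  have "(\<Sum>a \<in> level n (p + q) \<times> level n' (p' + q').
      \<Sum>b \<in> ?T a. F (fst b) (snd b) (fst a - fst b) (snd a - snd b))
    = (\<Sum>(a, b) \<in> Sigma (level n (p + q) \<times> level n' (p' + q')) ?T.
        F (fst b) (snd b) (fst a - fst b) (snd a - snd b))"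
    by (intro sum.Sigma) (auto simp: finite_level fin)
  also have "\<dots> = (\<Sum>(b, c) \<in> (level n p \<times> level n' p') \<times> (level n q \<times> level n' q').
        F (fst b) (snd b) (fst c) (snd c))"
    by (rule sum.reindex_bij_witness
        [where j = "\<lambda>(a, b). (b, (fst a - fst b, snd a - snd b))"
          and i = "\<lambda>(b, c). ((fst b + fst c, snd b + snd c), b)"])
      (auto simp: sub add le intro: level_minus level_plus)
  also have "\<dots> = (\<Sum>b \<in> level n p \<times> level n' p'. \<Sum>c \<in> level n q \<times> level n' q'.
        F (fst b) (snd b) (fst c) (snd c))"
    by (intro sum.Sigma[symmetric]) (auto simp: finite_level)
  finally show ?thesis
    by (simp add: case_prod_unfold)
qed

lemma block_norm_odot_le:
  assumes "\<rho> \<ge> 1"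
  shows "block_norm \<rho> n n' (p + q) (p' + q') (block_odot n n' p p' q q' A B)
    \<le> block_norm \<rho> n n' p p' A * block_norm \<rho> n n' q q' B"
proof -
  let ?P = "block_odot n n' p p' q q' A B"
  have "block_norm \<rho> n n' (p + q) (p' + q') ?P powr \<rho>
    \<le> (\<Sum>(\<alpha>, \<alpha>') \<in> level n (p + q) \<times> level n' (p' + q').
      \<Sum>(\<beta>, \<beta>') \<in> {\<beta> \<in> level n p. \<beta> \<le> \<alpha>} \<times> {\<beta>' \<in> level n' p'. \<beta>' \<le> \<alpha>'}.
        (norm (A \<beta> \<beta>') powr \<rho> / block_weight \<rho> n p p' \<beta>) *
        (norm (B (\<alpha> - \<beta>) (\<alpha>' - \<beta>')) powr \<rho> / block_weight \<rho> n q q' (\<alpha> - \<beta>)))"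
    unfolding block_norm_powr[OF assms] using block_odot_entry_le[OF assms]
    by (intro sum_mono) (clarify, blast)
  also have "\<dots> = (\<Sum>(\<beta>, \<beta>') \<in> level n p \<times> level n' p'. \<Sum>(\<gamma>, \<gamma>') \<in> level n q \<times> level n' q'.
        (norm (A \<beta> \<beta>') powr \<rho> / block_weight \<rho> n p p' \<beta>) *
        (norm (B \<gamma> \<gamma>') powr \<rho> / block_weight \<rho> n q q' \<gamma>))"
    by (rule sum_level_convolution)
  also have "\<dots> = block_norm \<rho> n n' p p' A powr \<rho> * block_norm \<rho> n n' q q' B powr \<rho>"
    unfolding block_norm_powr[OF assms] by (simp only: sum_product case_prod_unfold)
  also have "\<dots> = (block_norm \<rho> n n' p p' A * block_norm \<rho> n n' q q' B) powr \<rho>"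
    by (simp add: powr_mult)
  finally show ?thesis
    using powr_less_mono2[of \<rho> "block_norm \<rho> n n' p p' A * block_norm \<rho> n n' q q' B"
        "block_norm \<rho> n n' (p + q) (p' + q') ?P"] assms
    by (force simp: block_norm_nonneg not_le[symmetric])
qed

section \<open>Summing over the blocks\<close>

text \<open>
  By nonnegativity the products \<open>f a * g b\<close> are summable over all pairs of positions, with sum
  \<open>s * t\<close>. The Cauchy product groups these pairs by the finite fibres of \<open>(a, b) \<mapsto> a + b\<close>.
\<close>

lemma double_cauchy_product_has_sum:
  fixes f g :: "nat \<Rightarrow> nat \<Rightarrow> real"
  assumes f: "((\<lambda>(p, p'). f p p') has_sum s) UNIV" and g: "((\<lambda>(p, p'). g p p') has_sum t) UNIV"
    and f0: "\<And>p p'. f p p' \<ge> 0" and g0: "\<And>p p'. g p p' \<ge> 0"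
  shows "((\<lambda>(p, p'). \<Sum>q\<le>p. \<Sum>q'\<le>p'. f q q' * g (p - q) (p' - q')) has_sum s * t) UNIV"
proof -
  let ?h = "\<lambda>(a, b). f (fst a) (snd a) * g (fst b) (snd b)"
  have inner: "((\<lambda>b. ?h (a, b)) has_sum f (fst a) (snd a) * t) UNIV" for a
    using has_sum_cmult_right[OF g, of "f (fst a) (snd a)"] by (simp add: case_prod_unfold)
  have outer: "((\<lambda>a. f (fst a) (snd a) * t) has_sum s * t) UNIV"
    using has_sum_cmult_left[OF f, of t] by (simp add: case_prod_unfold)
  have "?h summable_on Sigma UNIV (\<lambda>_. UNIV)"
    using inner has_sum_imp_summable[OF outer] by (rule summable_on_SigmaI) (simp add: f0 g0)
  with inner outer have "(?h has_sum s * t) (Sigma UNIV (\<lambda>_. UNIV))"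
    by (rule has_sum_SigmaI)
  also have "?this \<longleftrightarrow> ((\<lambda>(c, a). f (fst a) (snd a) * g (fst c - fst a) (snd c - snd a)) has_sum s * t)
      (Sigma UNIV (\<lambda>c. {..fst c} \<times> {..snd c}))"
    by (rule has_sum_reindex_bij_witness
        [where j = "\<lambda>(a, b). ((fst a + fst b, snd a + snd b), a)"
          and i = "\<lambda>(c, a). (a, (fst c - fst a, snd c - snd a))"]) auto
  finally have "((\<lambda>c. \<Sum>a\<in>{..fst c} \<times> {..snd c}. f (fst a) (snd a) * g (fst c - fst a) (snd c - snd a))
      has_sum s * t) UNIV"
    by (rule has_sum_SigmaD) (auto intro!: has_sum_finiteI)
  then show ?thesis
    by (simp add: case_prod_unfold sum.cartesian_product)
qed

lemma mat_norm_has_sum: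
  assumes "mat_norm_defined \<rho> n n' A"
  shows "((\<lambda>(p, p'). block_norm \<rho> n n' p p' (A p p')) has_sum mat_norm \<rho> n n' A) UNIV"
  using assms unfolding mat_norm_defined_def mat_norm_def by (rule has_sum_infsum)

text \<open>
  A summable majorant settles both that the norm is defined and how large it is. This is how the
  sum and the product of block matrices are treated.
\<close>

lemma mat_norm_le:
  assumes "(g has_sum s) UNIV" "\<And>p p'. block_norm \<rho> n n' p p' (A p p') \<le> g (p, p')"
  shows "mat_norm_defined \<rho> n n' A \<and> mat_norm \<rho> n n' A \<le> s"
proof
  show def: "mat_norm_defined \<rho> n n' A"
    unfolding mat_norm_defined_def using has_sum_imp_summable[OF assms(1)]
    by (rule summable_on_comparison_test) (auto simp: assms(2) block_norm_nonneg)
  show "mat_norm \<rho> n n' A \<le> s"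
    using mat_norm_has_sum[OF def] assms(1) by (rule has_sum_mono) (auto simp: assms(2))
qed

lemma mat_norm_eq_0_iff:
  assumes "\<rho> \<ge> 1" "A \<in> Mat n n'" "mat_norm_defined \<rho> n n' A"
  shows "mat_norm \<rho> n n' A = 0 \<longleftrightarrow> A = 0"
proof
  assume "mat_norm \<rho> n n' A = 0"
  then have zero: "(\<lambda>(p, p'). block_norm \<rho> n n' p p' (A p p')) x = 0" for x
    using assms(3) unfolding mat_norm_def mat_norm_defined_def
    by (intro nonneg_infsum_le_0D[where A = UNIV]) (auto simp: block_norm_nonneg)
  have "block_norm \<rho> n n' p p' (A p p') = 0" for p p'
    using zero[of "(p, p')"] by simp
  moreover have "A p p' \<in> Block n n' p p'" for p p'
    using assms(2) by (simp add: Mat_def)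
  ultimately have "A p p' = 0" for p p'
    by (metis block_norm_eq_0_imp[OF assms(1)])
  then show "A = 0" by (simp add: fun_eq_iff)
qed (simp add: mat_norm_def block_norm_zero case_prod_unfold)

lemma mat_norm_scale:
  assumes "\<rho> \<ge> 1" "mat_norm_defined \<rho> n n' A"
  shows "mat_norm_defined \<rho> n n' (mat_scale c A) \<and>
    mat_norm \<rho> n n' (mat_scale c A) = norm c * mat_norm \<rho> n n' A"
proof -
  have "((\<lambda>(p, p'). block_norm \<rho> n n' p p' (mat_scale c A p p')) has_sum
      norm c * mat_norm \<rho> n n' A) UNIV"
    using has_sum_cmult_right[OF mat_norm_has_sum[OF assms(2)], of "norm c"]
    by (simp add: mat_scale_def block_norm_scale[OF assms(1)] case_prod_unfold)
  then show ?thesis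
    unfolding mat_norm_defined_def mat_norm_def
    by (auto intro: has_sum_imp_summable infsumI)
qed

lemma mat_norm_add_le:
  assumes "\<rho> \<ge> 1" "mat_norm_defined \<rho> n n' A" "mat_norm_defined \<rho> n n' B"
  shows "mat_norm_defined \<rho> n n' (A + B) \<and>
    mat_norm \<rho> n n' (A + B) \<le> mat_norm \<rho> n n' A + mat_norm \<rho> n n' B"
  using has_sum_add[OF mat_norm_has_sum[OF assms(2)] mat_norm_has_sum[OF assms(3)]]
  by (rule mat_norm_le) (simp add: block_norm_add_le[OF assms(1)])

lemma mat_norm_odot_le:
  assumes "\<rho> \<ge> 1" "mat_norm_defined \<rho> n n' A" "mat_norm_defined \<rho> n n' B"
  shows "mat_norm_defined \<rho> n n' (mat_odot n n' A B) \<and>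
    mat_norm \<rho> n n' (mat_odot n n' A B) \<le> mat_norm \<rho> n n' A * mat_norm \<rho> n n' B"
proof (rule mat_norm_le[OF double_cauchy_product_has_sum
      [OF mat_norm_has_sum[OF assms(2)] mat_norm_has_sum[OF assms(3)]]])
  fix p p'
  let ?P = "\<lambda>q q'. block_odot n n' q q' (p - q) (p' - q') (A q q') (B (p - q) (p' - q'))"
  have "block_norm \<rho> n n' p p' (mat_odot n n' A B p p')
      \<le> (\<Sum>q\<le>p. \<Sum>q'\<le>p'. block_norm \<rho> n n' p p' (?P q q'))"
    unfolding mat_odot_def
    by (intro order.trans[OF block_norm_sum_le] sum_mono block_norm_sum_le assms(1))
  also have "\<dots> \<le> (\<Sum>q\<le>p. \<Sum>q'\<le>p'. block_norm \<rho> n n' q q' (A q q')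
      * block_norm \<rho> n n' (p - q) (p' - q') (B (p - q) (p' - q')))"
  proof (intro sum_mono)
    fix q q' assume "q \<in> {..p}" "q' \<in> {..p'}"
    then show "block_norm \<rho> n n' p p' (?P q q') \<le> block_norm \<rho> n n' q q' (A q q')
      * block_norm \<rho> n n' (p - q) (p' - q') (B (p - q) (p' - q'))"
      using block_norm_odot_le[OF assms(1), of n n' q "p - q" q' "p' - q'"] by simp
  qed
  finally show "block_norm \<rho> n n' p p' (mat_odot n n' A B p p')
      \<le> (case (p, p') of (p, p') \<Rightarrow> \<Sum>q\<le>p. \<Sum>q'\<le>p'. block_norm \<rho> n n' q q' (A q q')
      * block_norm \<rho> n n' (p - q) (p' - q') (B (p - q) (p' - q')))"
    by simp
qed (simp_all add: block_norm_nonneg)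

theorem theorem1:
  fixes n n' :: nat and \<rho> :: real
    and A B :: "'a::real_normed_field block_matrix" and c :: 'a
  assumes "\<rho> \<ge> 1"
    and "A \<in> Mat n n'" and "B \<in> Mat n n'"
    and "mat_norm_defined \<rho> n n' A" and "mat_norm_defined \<rho> n n' B"
  shows "(mat_norm \<rho> n n' A = 0 \<longleftrightarrow> A = 0) \<and>
    (mat_norm_defined \<rho> n n' (mat_scale c A) \<and>
      mat_norm \<rho> n n' (mat_scale c A) = norm c * mat_norm \<rho> n n' A) \<and>
    (mat_norm_defined \<rho> n n' (A + B) \<and>
      mat_norm \<rho> n n' (A + B) \<le> mat_norm \<rho> n n' A + mat_norm \<rho> n n' B) \<and>
    (mat_norm_defined \<rho> n n' (mat_odot n n' A B) \<and>
      mat_norm \<rho> n n' (mat_odot n n' A B) \<le> mat_norm \<rho> n n' A * mat_norm \<rho> n n' B)"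
  using mat_norm_eq_0_iff[OF assms(1,2,4)] mat_norm_scale[OF assms(1,4)]
    mat_norm_add_le[OF assms(1,4,5)] mat_norm_odot_le[OF assms(1,4,5)]
  by blast

end
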